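(* Let $\mathcal R$ be the set of all $(z,x,y,w,\pi,\mu,\theta)$ satisfying $$\begin{aligned} &(z,x)\in\overline{\mathcal P},\quad 0\le z\le\overline z,\quad 0\le x\le\overline x,\quad \pi\ge0,\\ &Gy+Hw-\begin{pmatrix} x \\ 0 \end{pmatrix}=h,\quad 0\le y\le\overline y,\quad 0\le w\le\overline w,\quad \mu\ge0,\quad \theta\ge0,\\ &\Phi(y)+G^\top\pi+\theta^y-\mu^y=0,\quad H^\top\pi+\theta^w-\mu^w=0. \end{aligned}$$ Define $$\vartheta_{\mathrm{KKT}}^{\mathrm{relax}}=\max_{(z,x,y,w,\pi,\mu,\theta)\in\mathcal R}\ \pi_0^\top x-c_x^\top x-c_z^\top z,$$ $$\vartheta_{\mathrm{dual}}^{\mathrm{relax}}=\max_{(z,x,y,w,\pi,\mu,\theta)\in\mathcal R}\ -\langle\Phi(y),y\rangle-\overline w^\top\theta^w-\overline y^\top\theta^y-h^\top\pi-c_x^\top x-c_z^\top z.$$ Then $\vartheta_{\mathrm{dual}}^{\mathrm{relax}}\le\vartheta_{\mathrm{KKT}}^{\mathrm{relax}}$.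
   Context: Leader. $\overline{\mathcal P}\subseteq\mathbb R^{d_z+d_x}$ is a closed convex set (in the unrelaxed problem, $(z,x)$ lies in $\mathcal P=\overline{\mathcal P}\cap(\mathcal Z\times\mathcal X)$ with $\mathcal Z=\mathbb Z^{d_z^I}\times\mathbb R^{d_z-d_z^I}$, $\mathcal X=\mathbb Z^{d_x^I}\times\mathbb R^{d_x-d_x^I}$). The bounds $\overline z,\overline x$ are finite; $c_z,c_x$ are given cost vectors. Follower. For a leader decision $x$, the follower feasible set $\mathcal Y(x)$ is the set of $(y,w)\in\mathbb R^{d_y+d_w}$ with $G_0y+H_0w-x=h_0$, $G_1y+H_1w=h_1$, $0\le y\le\overline y$, $0\le w\le\overline w$, where components of $\overline y,\overline w$ may be $+\infty$. Write $G=\begin{pmatrix} G_0 \\ G_1 \end{pmatrix}$, $H=\begin{pmatrix} H_0 \\ H_1 \end{pmatrix}$, $h=\begin{pmatrix} h_0 \\ h_1 \end{pmatrix}$. The vectors $\pi=(\pi_0,\pi_1)$, $\mu=(\mu^y,\mu^w)$, $\theta=(\theta^y,\theta^w)$ are dual variables of the equalities, of $y,w\ge0$, and of $y\le\overline y$, $w\le\overline w$, respectively. If an upper bound is $+\infty$, the corresponding component of $\theta$ is fixed to $0$ and its product with the bound is $0$. Standing assumptions. (1) $\Phi:\mathrm{dom}(\Phi)\subseteq\mathbb R^{d_y}\to\mathbb R^{d_y}$ is continuously differentiable with symmetric Jacobian (with $y\in\mathrm{dom}(\Phi)$ implicitly required). (2) $\Phi$ is strictly monotone: $\langle\Phi(y^1)-\Phi(y^2),y^1-y^2\rangle>0$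 for all $y^1\neq y^2$ in $\mathrm{dom}(\Phi)$. (3) For every feasible leader decision $x$ there is $(y^*,w^* )\in\mathcal Y(x)$ with $\langle\Phi(y^* ),y'-y^*\rangle\ge0$ for all $y'\in\mathrm{proj}_y\mathcal Y(x)$. Optimal values are understood as suprema in $[-\infty,+\infty]$. *)

theory Defs
  imports "HOL-Analysis.Analysis"
begin

text \<open>
  Decision vectors are indexed by finite types: leader \<open>z\<close>, \<open>x\<close>; follower \<open>y\<close>, \<open>w\<close>.
  The coupling equalities share the index type \<open>'x\<close> of \<open>x\<close>, the remaining equalities are
  indexed by \<open>'m\<close>. Bounds that may be \<open>+\<infinity>\<close> are vectors over \<^typ>\<open>ereal\<close>.
\<close>

(* Used both for vectors and, since a matrix is a vector of rows, for block matrices. *)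
definition stack :: "'a ^ 'm \<Rightarrow> 'a ^ 'n \<Rightarrow> 'a ^ ('m + 'n)" where
  "stack a b = (\<chi> i. case i of Inl j \<Rightarrow> a $ j | Inr k \<Rightarrow> b $ k)"

definition below_bound :: "real ^ 'n \<Rightarrow> ereal ^ 'n \<Rightarrow> bool" where
  "below_bound v u \<longleftrightarrow> (\<forall>i. ereal (v $ i) \<le> u $ i)"

definition zero_at_infinite :: "ereal ^ 'n \<Rightarrow> real ^ 'n \<Rightarrow> bool" where
  "zero_at_infinite u \<theta> \<longleftrightarrow> (\<forall>i. u $ i = \<infinity> \<longrightarrow> \<theta> $ i = 0)"

definition bound_inner :: "ereal ^ 'n \<Rightarrow> real ^ 'n \<Rightarrow> real" where
  "bound_inner u \<theta> = (\<Sum>i\<in>UNIV. if u $ i = \<infinity> then 0 else real_of_ereal (u $ i) * \<theta> $ i)"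

(* Derivatives are taken within D, so D need not be open. *)
definition C1_symmetric_jacobian_on ::
    "(real ^ 'n) set \<Rightarrow> (real ^ 'n \<Rightarrow> real ^ 'n) \<Rightarrow> bool" where
  "C1_symmetric_jacobian_on D \<Phi> \<longleftrightarrow>
     (\<exists>J :: real ^ 'n \<Rightarrow> real ^ 'n ^ 'n.
        (\<forall>y\<in>D. (\<Phi> has_derivative (\<lambda>v. J y *v v)) (at y within D)) \<and>
        continuous_on D J \<and>
        (\<forall>y\<in>D. transpose (J y) = J y))"

definition strictly_monotone_on ::
    "(real ^ 'n) set \<Rightarrow> (real ^ 'n \<Rightarrow> real ^ 'n) \<Rightarrow> bool" where
  "strictly_monotone_on D \<Phi> \<longleftrightarrow>
     (\<forall>y1\<in>D. \<forall>y2\<in>D. y1 \<noteq> y2 \<longrightarrow> (\<Phi> y1 - \<Phi> y2) \<bullet> (y1 - y2) > 0)"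

(* Iz and Ix are the index sets of the integer components. *)
definition leader_decisions ::
    "((real ^ 'z) \<times> (real ^ 'x)) set \<Rightarrow> 'z set \<Rightarrow> 'x set \<Rightarrow> real ^ 'z \<Rightarrow> real ^ 'x
      \<Rightarrow> (real ^ 'x) set" where
  "leader_decisions P Iz Ix zbar xbar =
     {x. \<exists>z. (z, x) \<in> P \<and> (\<forall>i\<in>Iz. z $ i \<in> \<int>) \<and> (\<forall>i\<in>Ix. x $ i \<in> \<int>) \<and>
             0 \<le> z \<and> z \<le> zbar \<and> 0 \<le> x \<and> x \<le> xbar}"

(* D is the domain of the follower's map; y \<in> D is an implicit constraint. *)
definition follower_feasible ::
    "(real ^ 'y) set \<Rightarrow> real ^ 'y ^ 'x \<Rightarrow> real ^ 'y ^ 'm \<Rightarrow> real ^ 'w ^ 'x \<Rightarrow> real ^ 'w ^ 'm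
      \<Rightarrow> real ^ 'x \<Rightarrow> real ^ 'm \<Rightarrow> ereal ^ 'y \<Rightarrow> ereal ^ 'w
      \<Rightarrow> real ^ 'x \<Rightarrow> ((real ^ 'y) \<times> (real ^ 'w)) set" where
  "follower_feasible D G0 G1 H0 H1 h0 h1 ybar wbar x =
     {(y, w). y \<in> D \<and>
        G0 *v y + H0 *v w - x = h0 \<and> G1 *v y + H1 *v w = h1 \<and>
        0 \<le> y \<and> below_bound y ybar \<and> 0 \<le> w \<and> below_bound w wbar}"

type_synonym ('z, 'x, 'y, 'w, 'm) point =
  "(real ^ 'z) \<times> (real ^ 'x) \<times> (real ^ 'y) \<times> (real ^ 'w) \<times>
   ((real ^ 'x) \<times> (real ^ 'm)) \<times> ((real ^ 'y) \<times> (real ^ 'w)) \<times> ((real ^ 'y) \<times> (real ^ 'w))"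

definition relaxed_region ::
    "((real ^ 'z) \<times> (real ^ 'x)) set \<Rightarrow> real ^ 'z \<Rightarrow> real ^ 'x
      \<Rightarrow> (real ^ 'y) set \<Rightarrow> (real ^ 'y \<Rightarrow> real ^ 'y)
      \<Rightarrow> real ^ 'y ^ ('x + 'm::finite) \<Rightarrow> real ^ 'w ^ ('x + 'm::finite) \<Rightarrow> real ^ ('x + 'm::finite)
      \<Rightarrow> ereal ^ 'y \<Rightarrow> ereal ^ 'w \<Rightarrow> ('z, 'x, 'y, 'w, 'm) point set" where
  "relaxed_region P zbar xbar D \<Phi> G H h ybar wbar =
     {(z, x, y, w, (\<pi>0, \<pi>1), (\<mu>y, \<mu>w), (\<theta>y, \<theta>w)).
        (z, x) \<in> P \<and> 0 \<le> z \<and> z \<le> zbar \<and> 0 \<le> x \<and> x \<le> xbar \<and>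
        0 \<le> \<pi>0 \<and> 0 \<le> \<pi>1 \<and>
        y \<in> D \<and> G *v y + H *v w - stack x 0 = h \<and>
        0 \<le> y \<and> below_bound y ybar \<and> 0 \<le> w \<and> below_bound w wbar \<and>
        0 \<le> \<mu>y \<and> 0 \<le> \<mu>w \<and> 0 \<le> \<theta>y \<and> 0 \<le> \<theta>w \<and>
        zero_at_infinite ybar \<theta>y \<and> zero_at_infinite wbar \<theta>w \<and>
        \<Phi> y + transpose G *v stack \<pi>0 \<pi>1 + \<theta>y - \<mu>y = 0 \<and>
        transpose H *v stack \<pi>0 \<pi>1 + \<theta>w - \<mu>w = 0}"

definition kkt_objective ::
    "real ^ 'z \<Rightarrow> real ^ 'x \<Rightarrow> ('z, 'x, 'y, 'w, 'm) point \<Rightarrow> real" where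
  "kkt_objective cz cx = (\<lambda>(z, x, y, w, (\<pi>0, \<pi>1), \<mu>, \<theta>). \<pi>0 \<bullet> x - cx \<bullet> x - cz \<bullet> z)"

definition dual_objective ::
    "real ^ 'z \<Rightarrow> real ^ 'x \<Rightarrow> (real ^ 'y \<Rightarrow> real ^ 'y) \<Rightarrow> real ^ ('x + 'm::finite)
      \<Rightarrow> ereal ^ 'y \<Rightarrow> ereal ^ 'w \<Rightarrow> ('z, 'x, 'y, 'w, 'm) point \<Rightarrow> real" where
  "dual_objective cz cx \<Phi> h ybar wbar =
     (\<lambda>(z, x, y, w, (\<pi>0, \<pi>1), \<mu>, (\<theta>y, \<theta>w)).
        - (\<Phi> y \<bullet> y) - bound_inner wbar \<theta>w - bound_inner ybar \<theta>y - h \<bullet> stack \<pi>0 \<pi>1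
        - cx \<bullet> x - cz \<bullet> z)"

(* The supremum is taken in ereal, so an infeasible problem has value -\<infinity>. *)
definition optimal_value :: "'a set \<Rightarrow> ('a \<Rightarrow> real) \<Rightarrow> ereal" where
  "optimal_value R f = (SUP p\<in>R. ereal (f p))"

end

theory Submission imports Defs begin

text \<open>
  Both problems maximise over the same region, so it suffices to compare the two objectives at one
  feasible point. Substituting the primal equalities into \<open>h \<bullet> \<pi>\<close> cancels the bilinear term
  \<open>\<pi>\<^sub>0 \<bullet> x\<close> of the KKT objective, and the stationarity conditions then turn the KKT objective minus
  the dual objective into the complementarity gap
  \<open>\<mu>y \<bullet> y + \<mu>w \<bullet> w + (ybar \<bullet> \<theta>y - \<theta>y \<bullet> y) + (wbar \<bullet> \<theta>w - \<theta>w \<bullet> w)\<close>.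
  The relaxation drops complementary slackness, so this gap need not vanish, but every summand of it
  is nonnegative: the first two because all vectors involved are nonnegative, the last two by
  \<open>inner_le_bound_inner\<close>. At a point where complementary slackness holds the two objectives agree.
\<close>

lemma inner_stack:
  fixes a c :: "real ^ 'm" and b d :: "real ^ 'n"
  shows "stack a b \<bullet> stack c d = a \<bullet> c + b \<bullet> d"
proof -
  have "stack a b \<bullet> stack c d =
      (\<Sum>i\<in>UNIV <+> UNIV. stack a b $ i * stack c d $ i)"
    by (simp add: inner_vec_def)
  also have "\<dots> = a \<bullet> c + b \<bullet> d"
    by (subst sum.Plus) (simp_all add: stack_def inner_vec_def)
  finally show ?thesis .
qed

lemma inner_nonneg_vec:
  fixes a b :: "real ^ 'n"
  assumes "0 \<le> a" and "0 \<le> b"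
  shows "0 \<le> a \<bullet> b"
  using assms by (auto simp: inner_vec_def less_eq_vec_def intro!: sum_nonneg)

text \<open>
  This is where the convention \<open>\<theta>\<^sub>i = 0\<close> at an infinite bound enters: it makes the missing summands
  of \<open>bound_inner\<close> agree with those of \<open>\<theta> \<bullet> v\<close>. The value
  \<open>-\<infinity>\<close> is excluded because the bound dominates a real vector.
\<close>

lemma inner_le_bound_inner:
  fixes v \<theta> :: "real ^ 'n"
  assumes "below_bound v u" and "zero_at_infinite u \<theta>" and "0 \<le> \<theta>"
  shows "\<theta> \<bullet> v \<le> bound_inner u \<theta>"
  unfolding inner_vec_def bound_inner_def
proof (rule sum_mono)
  fix i
  have v: "ereal (v $ i) \<le> u $ i" and z: "u $ i = \<infinity> \<Longrightarrow> \<theta> $ i = 0" and nn: "0 \<le> \<theta> $ i"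
    using assms by (auto simp: below_bound_def zero_at_infinite_def less_eq_vec_def)
  show "\<theta> $ i \<bullet> v $ i \<le> (if u $ i = \<infinity> then 0 else real_of_ereal (u $ i) * \<theta> $ i)"
    using v z nn by (cases "u $ i") (auto simp: mult.commute[of "\<theta> $ i"] intro: mult_right_mono)
qed

lemma inner_transpose_matrix_vector:
  fixes A :: "real ^ 'n ^ 'm"
  shows "(A *v v) \<bullet> p = (transpose A *v p) \<bullet> v"
  by (simp add: dot_lmul_matrix inner_commute[of _ p])

text \<open>
  With the right-hand side written out, the term \<open>\<pi>\<^sub>0 \<bullet> x\<close> cancels and stationarity leaves
  only products of multipliers with slacks.
\<close>

lemma kkt_minus_dual_eq_complementarity_gap:
  fixes G :: "real ^ 'y ^ ('x::finite + 'm::finite)" and H :: "real ^ 'w ^ ('x::finite + 'm::finite)"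
    and x \<pi>0 :: "real ^ 'x::finite" and \<pi>1 :: "real ^ 'm::finite"
  assumes primal: "G *v y + H *v w - stack x 0 = h"
    and stat_y: "\<Phi> y + transpose G *v stack \<pi>0 \<pi>1 + \<theta>y - \<mu>y = 0"
    and stat_w: "transpose H *v stack \<pi>0 \<pi>1 + \<theta>w - \<mu>w = 0"
  shows "kkt_objective cz cx (z, x, y, w, (\<pi>0, \<pi>1), (\<mu>y, \<mu>w), (\<theta>y, \<theta>w))
       - dual_objective cz cx \<Phi> h ybar wbar (z, x, y, w, (\<pi>0, \<pi>1), (\<mu>y, \<mu>w), (\<theta>y, \<theta>w))
       = \<mu>y \<bullet> y + \<mu>w \<bullet> w + (bound_inner ybar \<theta>y - \<theta>y \<bullet> y) + (bound_inner wbar \<theta>w - \<theta>w \<bullet> w)"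
proof -
  have "transpose G *v stack \<pi>0 \<pi>1 = \<mu>y - \<theta>y - \<Phi> y"
    using stat_y by (simp add: algebra_simps)
  moreover have "transpose H *v stack \<pi>0 \<pi>1 = \<mu>w - \<theta>w"
    using stat_w by (simp add: algebra_simps)
  ultimately have "h \<bullet> stack \<pi>0 \<pi>1
      = (\<mu>y - \<theta>y - \<Phi> y) \<bullet> y + (\<mu>w - \<theta>w) \<bullet> w - \<pi>0 \<bullet> x"
    unfolding primal[symmetric]
    by (simp add: inner_diff_left inner_add_left inner_transpose_matrix_vector inner_stack
        inner_commute[of x])
  then show ?thesis
    by (simp add: kkt_objective_def dual_objective_def inner_diff_left)
qed

lemma dual_le_kkt_on_relaxed_region:
  assumes "p \<in> relaxed_region P zbar xbar D \<Phi> G H h ybar wbar"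
  shows "dual_objective cz cx \<Phi> h ybar wbar p \<le> kkt_objective cz cx p"
proof -
  obtain z x y w \<pi>0 \<pi>1 \<mu>y \<mu>w \<theta>y \<theta>w
    where p: "p = (z, x, y, w, (\<pi>0, \<pi>1), (\<mu>y, \<mu>w), (\<theta>y, \<theta>w))"
    by (metis prod.exhaust)
  have eqs: "G *v y + H *v w - stack x 0 = h"
      "\<Phi> y + transpose G *v stack \<pi>0 \<pi>1 + \<theta>y - \<mu>y = 0"
      "transpose H *v stack \<pi>0 \<pi>1 + \<theta>w - \<mu>w = 0"
    and y: "0 \<le> y" "below_bound y ybar" "zero_at_infinite ybar \<theta>y" "0 \<le> \<theta>y" "0 \<le> \<mu>y"
    and w: "0 \<le> w" "below_bound w wbar" "zero_at_infinite wbar \<theta>w" "0 \<le> \<theta>w" "0 \<le> \<mu>w"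
    using assms unfolding p relaxed_region_def by auto
  show ?thesis
    using kkt_minus_dual_eq_complementarity_gap[where \<Phi> = \<Phi> and cz = cz and cx = cx and z = z
        and ybar = ybar and wbar = wbar, OF eqs]
      inner_nonneg_vec[OF y(5,1)] inner_nonneg_vec[OF w(5,1)]
      inner_le_bound_inner[OF y(2-4)] inner_le_bound_inner[OF w(2-4)]
    unfolding p by linarith
qed

theorem lemma2:
  fixes P :: "((real ^ 'z) \<times> (real ^ 'x)) set"
    and Iz :: "'z set" and Ix :: "'x set"
    and zbar cz :: "real ^ 'z" and xbar cx :: "real ^ 'x"
    and G0 :: "real ^ 'y ^ 'x" and G1 :: "real ^ 'y ^ 'm"
    and H0 :: "real ^ 'w ^ 'x" and H1 :: "real ^ 'w ^ 'm"
    and h0 :: "real ^ 'x" and h1 :: "real ^ 'm"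
    and ybar :: "ereal ^ 'y" and wbar :: "ereal ^ 'w"
    and D :: "(real ^ 'y) set" and \<Phi> :: "real ^ 'y \<Rightarrow> real ^ 'y"
  assumes "closed P" and "convex P"
    and "\<And>i. ybar $ i \<noteq> -\<infinity>" and "\<And>i. wbar $ i \<noteq> -\<infinity>"
    and "C1_symmetric_jacobian_on D \<Phi>"
    and "strictly_monotone_on D \<Phi>"
    and "\<And>x. x \<in> leader_decisions P Iz Ix zbar xbar \<Longrightarrow>
           \<exists>(ys, ws) \<in> follower_feasible D G0 G1 H0 H1 h0 h1 ybar wbar x.
             \<forall>y' \<in> fst ` follower_feasible D G0 G1 H0 H1 h0 h1 ybar wbar x.
               \<Phi> ys \<bullet> (y' - ys) \<ge> 0"
  shows "optimal_value
           (relaxed_region P zbar xbar D \<Phi> (stack G0 G1) (stack H0 H1) (stack h0 h1) ybar wbar)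
           (dual_objective cz cx \<Phi> (stack h0 h1) ybar wbar)
       \<le> optimal_value
           (relaxed_region P zbar xbar D \<Phi> (stack G0 G1) (stack H0 H1) (stack h0 h1) ybar wbar)
           (kkt_objective cz cx)"
  unfolding optimal_value_def
  by (rule SUP_mono) (auto intro: dual_le_kkt_on_relaxed_region)

end
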